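(* If $s$ is a power of $3$ (that is, $s=3^j$ for some integer $j\ge 0$), then $$g_1^{(3)}(s) = h_1^{(3)}(s)-1 = F_1(s) = T(s)=\frac{1}{4}\binom{s+1}{3}.$$
   Context: Definitions of the functions involved: (1) $f_3(N,s,t)$ is the largest integer $n$ for which every red-blue coloring of the $3$-element subsets of $[N]=\{1,\dots,N\}$ has a red $n$-element set (an $n$-element set all of whose triples are red) or a set of size $s$ which contains at least $t$ blue triples. (For $t=0$ the condition holds for every $n$, and $f_3(N,s,0)$ is regarded as larger than any power of $N$.) (2) $h_1^{(3)}(s)$ is the least $t$ for which $f_3(N,s,t)$ stops growing like a power of $N$ and starts growing like a power of $\log N$; that is, there are positive constants $c_1,c_2$ (depending on $s$) such that for all sufficiently large $N$, $f_3(N,s,h_1^{(3)}(s)-1)>N^{c_1}$ but $f_3(N,s,h_1^{(3)}(s))<(\log N)^{c_2}$. (3) $g_1^{(3)}$ is defined recursively by $g_1^{(3)}(0)=g_1^{(3)}(1)=g_1^{(3)}(2)=0$ and, for $s\ge 3$, $$g_1^{(3)}(s)=\max_{a+b+c=s}\big(g_1^{(3)}(a)+g_1^{(3)}(b)+g_1^{(3)}(c)+abc\big),$$ where the maximum is over nonnegative integers $a,b,c<s$ with $a+b+c=s$. (4) $F_1(s)$ is the maximum, over all colorings of the edges of the complete graph on $\{1,\dots,s\}$ with colors $I,II,III$, of the number of triples $(a,b,c)$ with $1\le a<b<c\le s$ such that $(a,b)$ has color $I$, $(b,c)$ has color $II$, and $(a,c)$ has color $III$. (5) $T(s)$ is the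 maximum number of directed (cyclic) triangles in a tournament on $s$ vertices. *)

theory Defs
  imports Complex_Main "HOL-Library.Ramsey" "HOL-Library.Extended_Real"
begin

section \<open>The Ramsey function \<open>f\<^sub>3(N, s, t)\<close>\<close>

datatype rb = Red | Blue

text \<open>
  A coloring of the triples of \<open>{1..N}\<close> is a function on all sets of naturals, of which only
  the values on \<open>[{1..N}]\<^bsup>3\<^esup>\<close> are ever used. Sets with fewer than three elements
  are vacuously red.
\<close>

definition f3_prop :: "nat \<Rightarrow> nat \<Rightarrow> nat \<Rightarrow> nat \<Rightarrow> bool" where
  "f3_prop N s t n \<longleftrightarrow>
     (\<forall>\<chi> :: nat set \<Rightarrow> rb.
        (\<exists>A \<in> [{1..N}]\<^bsup>n\<^esup>. \<forall>e \<in> [A]\<^bsup>3\<^esup>. \<chi> e = Red) \<or>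
        (\<exists>S \<in> [{1..N}]\<^bsup>s\<^esup>. t \<le> card {e \<in> [S]\<^bsup>3\<^esup>. \<chi> e = Blue}))"

text \<open>
  For \<open>t \<ge> 1\<close> the all-red coloring shows that only \<open>n \<le> N\<close> can qualify, and \<open>n = 0\<close> does, so
  the supremum is a maximum. For \<open>t = 0\<close> and \<open>N \<ge> s\<close> every \<open>n\<close> qualifies and the value is
  \<open>\<infinity>\<close>, which implements the convention that \<open>f\<^sub>3(N, s, 0)\<close> exceeds every power of \<open>N\<close>.
\<close>

definition f3 :: "nat \<Rightarrow> nat \<Rightarrow> nat \<Rightarrow> enat" where
  "f3 N s t = Sup {enat n | n. f3_prop N s t n}"

section \<open>The threshold \<open>h\<^sub>1(s)\<close> for triples\<close>

definition f3_transition :: "nat \<Rightarrow> nat \<Rightarrow> bool" where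
  "f3_transition s t \<longleftrightarrow> 1 \<le> t \<and>
     (\<exists>c1 > 0. \<exists>c2 > 0. \<forall>\<^sub>F N in sequentially.
        ereal (real N powr c1) < ereal_of_enat (f3 N s (t - 1)) \<and>
        ereal_of_enat (f3 N s t) < ereal (ln (real N) powr c2))"

text \<open>
  Since \<open>f3 N s t\<close> is antitone in \<open>t\<close>, at most one \<open>t\<close> satisfies \<open>f3_transition s t\<close>.
  If none does, \<open>h1_3 s\<close> is unspecified; statements about it have to assert
  \<open>f3_transition s (h1_3 s)\<close> in order to claim that the threshold exists.
\<close>

definition h1_3 :: "nat \<Rightarrow> nat" where
  "h1_3 s = (LEAST t. f3_transition s t)"

section \<open>The recursively defined function \<open>g\<^sub>1\<close>\<close>

function g1_3 :: "nat \<Rightarrow> nat" where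
  "g1_3 s = (if s < 3 then 0 else
     Max ((\<lambda>(a, b, c). g1_3 a + g1_3 b + g1_3 c + a * b * c) `
          {(a, b, c). a < s \<and> b < s \<and> c < s \<and> a + b + c = s}))"
  by auto
termination
  by (relation "measure id") auto

declare g1_3.simps [simp del]

section \<open>Edge colorings with three colors\<close>

datatype three_col = Col_I | Col_II | Col_III

definition F1 :: "nat \<Rightarrow> nat" where
  "F1 s = Max (range (\<lambda>\<chi> :: nat set \<Rightarrow> three_col.
     card {(a, b, c). 1 \<le> a \<and> a < b \<and> b < c \<and> c \<le> s \<and>
       \<chi> {a, b} = Col_I \<and> \<chi> {b, c} = Col_II \<and> \<chi> {a, c} = Col_III}))"

section \<open>Cyclic triangles in tournaments\<close>

definition tournament :: "'a set \<Rightarrow> ('a \<times> 'a) set \<Rightarrow> bool" where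
  "tournament V R \<longleftrightarrow> R \<subseteq> V \<times> V \<and> irrefl R \<and>
     (\<forall>u \<in> V. \<forall>v \<in> V. u \<noteq> v \<longrightarrow> ((u, v) \<in> R) \<noteq> ((v, u) \<in> R))"

text \<open>
  A cyclic triangle is counted as a set of vertices: on three given vertices, a tournament has at
  most one directed cycle.
\<close>

definition cyclic_triangles :: "('a \<times> 'a) set \<Rightarrow> 'a set set" where
  "cyclic_triangles R = {{x, y, z} | x y z. (x, y) \<in> R \<and> (y, z) \<in> R \<and> (z, x) \<in> R}"

definition T :: "nat \<Rightarrow> nat" where
  "T s = Max {card (cyclic_triangles R) | R. tournament {1..s} R}"

end

theory Submission
  imports Defs "HOL-Real_Asymp.Real_Asymp"
begin

text \<open>
  All quantities equal \<open>(s\<^sup>3 - s) / 24\<close>. The upper bound for \<open>g\<^sub>1\<close> is the arithmetic-geometric mean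
  inequality; for \<open>T\<close> it follows from counting the non-cyclic triples by their dominating vertex and
  convexity. A coloring becomes a tournament by directing pairs of color \<open>III\<close> downwards and all
  others upwards, which gives \<open>F\<^sub>1 \<le> T\<close>, and iterating the tripartition into thirds gives the lower
  bounds.

  For the threshold, color the cyclic triangles of a random tournament on \<open>N\<close> vertices blue: an
  \<open>s\<close>-set contains at most \<open>T(s)\<close> of them, and a red set is a transitive subtournament, hence of
  logarithmic size. Conversely, if there is no red set of size \<open>n = N\<^sup>c\<close>, then the blue triples have
  density at least \<open>n\<^sup>-\<^sup>3\<close> up to a constant. By induction every fairly large set contains a copy of
  the iterated construction on \<open>s / 3\<close> points, so pigeonholing over such copies turns the three
  vertices of a blue triple, one after the other, into copies with all transversal triples blue.
\<close>

section \<open>Thirds and the recursive function\<close>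

text \<open>The number of triples in the iterated balanced tripartite construction on \<open>3 ^ j\<close> points.\<close>

primrec tri :: "nat \<Rightarrow> nat" where
  "tri 0 = 0"
| "tri (Suc j) = 3 * tri j + (3 ^ j) ^ 3"

lemma tri_closed_form: "24 * tri j + 3 ^ j = (3 ^ j) ^ 3"
proof (induction j)
  case (Suc j)
  have "24 * tri (Suc j) + 3 ^ Suc j = 3 * (24 * tri j + 3 ^ j) + 24 * (3 ^ j) ^ 3"
    by simp
  then show ?case
    unfolding Suc.IH by (simp add: power_mult_distrib)
qed simp

lemma six_choose_three: "6 * real (n choose 3) = real n * (real n - 1) * (real n - 2)"
proof (induction n)
  case (Suc n)
  have "2 * real (n choose 2) = real n * (real n - 1)"
    by (induction n) (auto simp: numeral_2_eq_2 algebra_simps)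
  moreover have "Suc n choose 3 = (n choose 2) + (n choose 3)"
    by (simp add: numeral_3_eq_3 numeral_2_eq_2)
  ultimately show ?case
    using Suc by (simp add: algebra_simps)
qed simp

lemma real_tri: "24 * real (tri j) = real (3 ^ j) ^ 3 - real (3 ^ j)"
proof -
  have "real (24 * tri j + 3 ^ j) = real ((3 ^ j) ^ 3)"
    by (simp only: tri_closed_form)
  then show ?thesis by simp
qed

text \<open>With s = \<open>3 ^ j\<close>, the binomial coefficient is (s + 1) s (s - 1) / 6, which
  is (s^3 - s) / 6.\<close>

lemma tri_eq_choose: "real (tri j) = 1 / 4 * real ((3 ^ j + 1) choose 3)"
  using six_choose_three[of "3 ^ j + 1"] real_tri[of j]
  by (simp add: algebra_simps power3_eq_cube)

text \<open>The right side minus the left side is three times the sum of weighted squares in the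
  proof.\<close>

lemma cube_sum_bound:
  fixes a b c :: real
  assumes "a \<ge> 0" "b \<ge> 0" "c \<ge> 0"
  shows "a ^ 3 + b ^ 3 + c ^ 3 + 24 * a * b * c \<le> (a + b + c) ^ 3"
proof -
  have "0 \<le> a * (b - c)\<^sup>2 + b * (a - c)\<^sup>2 + c * (a - b)\<^sup>2"
    using assms by simp
  then show ?thesis
    by (simp add: power2_eq_square power3_eq_cube algebra_simps)
qed

text \<open>This works for every \<open>s\<close>: \<open>cube_sum_bound\<close> absorbs the three
  cubes and the product, and the linear terms add up exactly because
  \<open>a + b + c = s\<close>.\<close>

lemma g1_3_le: "24 * real (g1_3 s) \<le> real s ^ 3 - real s"
proof (induction s rule: less_induct)
  case (less s)
  show ?case
  proof (cases "s < 3")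
    case True
    then have "s \<in> {0, 1, 2}" by auto
    then show ?thesis by (auto simp: g1_3.simps)
  next
    case False
    let ?I = "{(a, b, c). a < s \<and> b < s \<and> c < s \<and> a + b + c = s}"
    let ?f = "\<lambda>(a, b, c). g1_3 a + g1_3 b + g1_3 c + a * b * c"
    have "finite ?I"
      by (rule finite_subset[of _ "{..s} \<times> {..s} \<times> {..s}"]) auto
    \<comment> \<open>A witness that the index set is nonempty, so that the maximum is
      attained.\<close>
    moreover have "(1, 1, s - 2) \<in> ?I" using False by auto
    ultimately have "Max (?f ` ?I) \<in> ?f ` ?I" by (intro Max_in finite_imageI) blast+
    moreover have "g1_3 s = Max (?f ` ?I)" using False by (subst g1_3.simps) simp
    ultimately obtain a b c where abc: "a < s" "b < s" "c < s" "a + b + c = s"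
      and g: "g1_3 s = g1_3 a + g1_3 b + g1_3 c + a * b * c" by auto
    have s: "real s = real a + real b + real c" using abc by auto
    show ?thesis
      using less[OF abc(1)] less[OF abc(2)] less[OF abc(3)]
        cube_sum_bound[of "real a" "real b" "real c"]
      unfolding g s by simp
  qed
qed

lemma g1_3_ge: "tri j \<le> g1_3 (3 ^ j)"
proof (induction j)
  case (Suc j)
  let ?m = "3 ^ j :: nat"
  let ?s = "3 ^ Suc j :: nat"
  let ?I = "{(a, b, c). a < ?s \<and> b < ?s \<and> c < ?s \<and> a + b + c = ?s}"
  let ?f = "\<lambda>(a, b, c). g1_3 a + g1_3 b + g1_3 c + a * b * c"
  have "finite ?I"
    by (rule finite_subset[of _ "{..?s} \<times> {..?s} \<times> {..?s}"]) auto
  then have "?f (?m, ?m, ?m) \<le> Max (?f ` ?I)"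
    by (intro Max_ge imageI finite_imageI) auto
  moreover have "g1_3 ?s = Max (?f ` ?I)"
    by (subst g1_3.simps) simp
  ultimately show ?case using Suc by (simp add: power3_eq_cube)
qed simp

lemma g1_3_power_three: "g1_3 (3 ^ j) = tri j"
proof -
  have "24 * real (g1_3 (3 ^ j)) \<le> 24 * real (tri j)"
    using g1_3_le[of "3 ^ j"] unfolding real_tri by simp
  then show ?thesis using g1_3_ge[of j] by linarith
qed

section \<open>Cyclic triangles\<close>

lemma tournament_subset: "tournament V R \<Longrightarrow> R \<subseteq> V \<times> V"
  by (simp add: tournament_def)

lemma tournament_finite: "tournament V R \<Longrightarrow> finite V \<Longrightarrow> finite R"
  by (metis finite_cartesian_product finite_subset tournament_subset)

lemma tournament_asym:
  assumes "tournament V R" "(x, y) \<in> R"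
  shows "x \<noteq> y" "(y, x) \<notin> R"
proof -
  show "x \<noteq> y" using assms by (auto simp: tournament_def irrefl_def)
  moreover have "x \<in> V" "y \<in> V" using assms tournament_subset by blast+
  ultimately show "(y, x) \<notin> R" using assms unfolding tournament_def by blast
qed

lemma tournament_total:
  assumes "tournament V R" "x \<in> V" "y \<in> V" "x \<noteq> y"
  shows "(x, y) \<in> R \<or> (y, x) \<in> R"
  using assms unfolding tournament_def by blast

lemma tournament_restrict:
  assumes "tournament V R" "S \<subseteq> V"
  shows "tournament S (R \<inter> S \<times> S)"
  unfolding tournament_def
proof (intro conjI ballI impI)
  show "irrefl (R \<inter> S \<times> S)" using assms by (auto simp: tournament_def irrefl_def)
next
  fix u v assume uv: "u \<in> S" "v \<in> S" "u \<noteq> v"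
  then have "((u, v) \<in> R) \<noteq> ((v, u) \<in> R)"
    using assms unfolding tournament_def by blast
  then show "((u, v) \<in> R \<inter> S \<times> S) \<noteq> ((v, u) \<in> R \<inter> S \<times> S)" using uv by blast
qed simp

lemma cyclic_triangles_subset:
  assumes "tournament V R"
  shows "cyclic_triangles R \<subseteq> [V]\<^bsup>3\<^esup>"
proof
  fix e assume "e \<in> cyclic_triangles R"
  then obtain x y z where e: "e = {x, y, z}" "(x, y) \<in> R" "(y, z) \<in> R" "(z, x) \<in> R"
    by (auto simp: cyclic_triangles_def)
  then have "x \<noteq> y" "y \<noteq> z" "z \<noteq> x" using tournament_asym(1)[OF assms] by blast+
  moreover have "x \<in> V" "y \<in> V" "z \<in> V" using e tournament_subset[OF assms] by blast+
  ultimately show "e \<in> [V]\<^bsup>3\<^esup>" unfolding e by (auto simp: nsets_def)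
qed

text \<open>The arcs and their reversals partition the ordered pairs of distinct vertices.\<close>

lemma card_tournament:
  assumes "tournament V R" "finite V"
  shows "2 * real (card R) = real (card V) * (real (card V) - 1)"
proof -
  have "card (R \<union> R\<inverse>) = card R + card (R\<inverse>)"
    using tournament_finite[OF assms] tournament_asym(2)[OF assms(1)]
    by (intro card_Un_disjoint) auto
  moreover have "R \<union> R\<inverse> = V \<times> V - (\<lambda>x. (x, x)) ` V"
    using tournament_subset[OF assms(1)] tournament_total[OF assms(1)] tournament_asym(1)[OF assms(1)]
    by fastforce
  moreover have "card (V \<times> V - (\<lambda>x. (x, x)) ` V) = card V * card V - card V"
    using assms by (subst card_Diff_subset) (auto simp: card_image inj_on_def card_cartesian_product)
  ultimately have "2 * card R = card V * card V - card V" by simp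
  then have "2 * real (card R) = real (card V * card V - card V)"
    by (metis of_nat_mult of_nat_numeral)
  then show ?thesis by (cases "card V") (auto simp: algebra_simps of_nat_diff)
qed

text \<open>A triple of vertices that is not cyclic has a unique vertex beating the other two.\<close>

lemma cyclic_triangles_add_out_pairs:
  assumes R: "tournament V R" and fin: "finite V"
  shows "card (cyclic_triangles R) + (\<Sum>v\<in>V. card (R `` {v}) choose 2) \<le> card V choose 3"
proof -
  let ?D = "SIGMA v:V. [R `` {v}]\<^bsup>2\<^esup>"
  let ?h = "\<lambda>(v, p). insert v p"
  have RV: "R `` {v} \<subseteq> V" for v using R by (auto simp: tournament_def)
  have finR: "finite (R `` {v})" for v using RV fin by (rule finite_subset)
  note asym = tournament_asym[OF R]
  have D: "\<exists>x y. p = {x, y} \<and> x \<noteq> y \<and> (v, x) \<in> R \<and> (v, y) \<in> R" if "(v, p) \<in> ?D" for v p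
    using that by (auto simp: nsets_def card_2_iff)
  have inj: "inj_on ?h ?D"
  proof (rule inj_onI, clarify)
    fix v p w q
    assume "v \<in> V" "p \<in> [R `` {v}]\<^bsup>2\<^esup>" "w \<in> V" "q \<in> [R `` {w}]\<^bsup>2\<^esup>"
      and eq: "insert v p = insert w q"
    then have "(v, p) \<in> ?D" "(w, q) \<in> ?D" by auto
    then have v: "\<And>x. x \<in> p \<Longrightarrow> (v, x) \<in> R" and w: "\<And>x. x \<in> q \<Longrightarrow> (w, x) \<in> R"
      using D by blast+
    \<comment> \<open>If \<open>v\<close> and \<open>w\<close> differed, each would lie in the
      other's pair, giving arcs in both directions.\<close>
    then have "v = w" using eq asym by (metis insertE insertI1)
    moreover have "v \<notin> p" "w \<notin> q" using v w asym by blast+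
    ultimately show "v = w \<and> p = q" using eq by (metis insert_ident)
  qed
  have sub: "?h ` ?D \<subseteq> [V]\<^bsup>3\<^esup>"
  proof clarify
    fix v p assume vp: "v \<in> V" "p \<in> [R `` {v}]\<^bsup>2\<^esup>"
    then have "v \<notin> p" using asym(1) by (fastforce simp: nsets_def)
    then show "insert v p \<in> [V]\<^bsup>3\<^esup>" using vp RV[of v] by (auto simp: nsets_def)
  qed
  \<comment> \<open>Every vertex of a cyclic triangle is beaten by another one, but the apex
    \<open>v\<close> beats both others.\<close>
  have disj: "cyclic_triangles R \<inter> ?h ` ?D = {}"
  proof (rule ccontr)
    assume "cyclic_triangles R \<inter> ?h ` ?D \<noteq> {}"
    then obtain v p where vp: "(v, p) \<in> ?D" "insert v p \<in> cyclic_triangles R" by auto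
    then obtain x y z where c: "insert v p = {x, y, z}" "(x, y) \<in> R" "(y, z) \<in> R" "(z, x) \<in> R"
      by (auto simp: cyclic_triangles_def)
    have "v \<in> {x, y, z}" using c(1) by blast
    then obtain u where "u \<in> {x, y, z}" "(u, v) \<in> R" using c(2-4) by blast
    then have u: "u \<in> insert v p" "(u, v) \<in> R" using c(1) by simp_all
    then have "(v, u) \<in> R" using D[OF vp(1)] asym by blast
    then show False using u asym by blast
  qed
  have fin3: "finite ([V]\<^bsup>3\<^esup>)" using fin by (simp add: finite_imp_finite_nsets)
  have "card (cyclic_triangles R) + card (?h ` ?D) = card (cyclic_triangles R \<union> ?h ` ?D)"
    using finite_subset[OF cyclic_triangles_subset[OF R] fin3] finite_subset[OF sub fin3] disj
    by (simp add: card_Un_disjoint)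
  also have "\<dots> \<le> card ([V]\<^bsup>3\<^esup>)"
    using fin3 sub cyclic_triangles_subset[OF R] by (intro card_mono) auto
  also have "card (?h ` ?D) = (\<Sum>v\<in>V. card (R `` {v}) choose 2)"
    using inj fin finR by (simp add: card_image card_SigmaI finite_imp_finite_nsets)
  finally show ?thesis by simp
qed

lemma card_cyclic_triangles_le:
  assumes R: "tournament V R" and fin: "finite V"
  shows "24 * real (card (cyclic_triangles R)) \<le> real (card V) ^ 3 - real (card V)"
proof -
  define s where "s = real (card V)"
  define d where "d v = real (card (R `` {v}))" for v
  have two: "2 * real (n choose 2) = real n * (real n - 1)" for n
    by (induction n) (auto simp: numeral_2_eq_2 algebra_simps)
  have "R = (SIGMA v:V. R `` {v})" using R by (auto simp: tournament_def)
  moreover have "finite (R `` {v})" for v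
    using tournament_finite[OF R fin] by (rule finite_Image)
  ultimately have "card R = (\<Sum>v\<in>V. card (R `` {v}))"
    using fin by (metis card_SigmaI)
  then have sumd: "2 * (\<Sum>v\<in>V. d v) = s * (s - 1)"
    using card_tournament[OF assms] by (simp add: d_def s_def)
  \<comment> \<open>The mean out-degree is (s - 1) / 2 by \<open>sumd\<close>; the summands are the
    squares of the doubled deviations from it.\<close>
  have "0 \<le> (\<Sum>v\<in>V. (2 * d v - (s - 1))\<^sup>2)" by (simp add: sum_nonneg)
  also have "\<dots> = (\<Sum>v\<in>V. 4 * (d v * (d v - 1)) + (8 - 4 * s) * d v + (s - 1)\<^sup>2)"
    by (intro sum.cong refl) (simp add: power2_eq_square algebra_simps)
  also have "\<dots> = 4 * (\<Sum>v\<in>V. d v * (d v - 1)) + (4 - 2 * s) * (2 * (\<Sum>v\<in>V. d v)) + s * (s - 1)\<^sup>2"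
    by (simp only: sum.distrib sum_distrib_left[symmetric] sum_constant)
      (simp add: s_def algebra_simps)
  also have "(\<Sum>v\<in>V. d v * (d v - 1)) = 2 * (\<Sum>v\<in>V. real (card (R `` {v}) choose 2))"
    by (simp add: sum_distrib_left two d_def)
  finally have A: "0 \<le> 8 * (\<Sum>v\<in>V. real (card (R `` {v}) choose 2))
      + (4 - 2 * s) * (s * (s - 1)) + s * (s - 1)\<^sup>2"
    unfolding sumd by simp
  have "real (card (cyclic_triangles R) + (\<Sum>v\<in>V. card (R `` {v}) choose 2)) \<le> real (card V choose 3)"
    using cyclic_triangles_add_out_pairs[OF assms] by (rule of_nat_mono)
  then have B: "24 * real (card (cyclic_triangles R)) + 24 * (\<Sum>v\<in>V. real (card (R `` {v}) choose 2))
      \<le> 4 * (s * (s - 1) * (s - 2))"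
    using six_choose_three[of "card V"] by (simp add: s_def)
  \<comment> \<open>By \<open>A\<close>, eight times the sum of the binomials is at least s (s - 1)
    (s - 3). Inserting three times this into \<open>B\<close> leaves s (s - 1) (s + 1).\<close>
  show ?thesis
    using A B unfolding s_def[symmetric] by (simp add: power2_eq_square power3_eq_cube algebra_simps)
qed

lemma card_cyclic_triangles_le_tri:
  assumes "tournament V R" "finite V" "card V = 3 ^ j"
  shows "card (cyclic_triangles R) \<le> tri j"
  using card_cyclic_triangles_le[OF assms(1,2)] real_tri[of j] assms(3) by simp

lemma finite_tournament_counts:
  assumes "finite V"
  shows "finite {card (cyclic_triangles R) | R. tournament V R}"
proof -
  have "{R. tournament V R} \<subseteq> Pow (V \<times> V)" by (auto simp: tournament_def)
  then have "finite {R. tournament V R}" by (rule finite_subset) (simp add: assms)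
  then show ?thesis by simp
qed

lemma T_le_tri: "T (3 ^ j) \<le> tri j"
proof -
  let ?A = "{card (cyclic_triangles R) | R. tournament {1..3 ^ j :: nat} R}"
  \<comment> \<open>The transitive tournament witnesses that there are counts to maximize
    over.\<close>
  have "tournament {1..3 ^ j} {(u, v). u \<in> {1..3 ^ j} \<and> v \<in> {1..3 ^ j} \<and> u < (v :: nat)}"
    by (auto simp: tournament_def irrefl_def)
  then have "?A \<noteq> {}" by blast
  then have "T (3 ^ j) \<in> ?A"
    unfolding T_def using finite_tournament_counts[of "{1..3 ^ j :: nat}"] by (intro Max_in) auto
  then obtain R where "tournament {1..3 ^ j :: nat} R" "T (3 ^ j) = card (cyclic_triangles R)" by blast
  then show ?thesis using card_cyclic_triangles_le_tri[of "{1..3 ^ j}" R j] by simp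
qed

section \<open>Rainbow triples\<close>

definition rainbow :: "nat \<Rightarrow> (nat set \<Rightarrow> three_col) \<Rightarrow> (nat \<times> nat \<times> nat) set" where
  "rainbow s \<chi> = {(a, b, c). 1 \<le> a \<and> a < b \<and> b < c \<and> c \<le> s \<and>
     \<chi> {a, b} = Col_I \<and> \<chi> {b, c} = Col_II \<and> \<chi> {a, c} = Col_III}"

lemma rainbow_subset: "rainbow s \<chi> \<subseteq> {..s} \<times> {..s} \<times> {..s}"
  by (auto simp: rainbow_def)

lemma finite_rainbow: "finite (rainbow s \<chi>)"
  using rainbow_subset by (rule finite_subset) simp

text \<open>There are infinitely many functions \<open>\<chi>\<close>, so finiteness comes from a
  uniform bound on the counts.\<close>

lemma finite_rainbow_counts: "finite (range (\<lambda>\<chi>. card (rainbow s \<chi>)))"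
proof (rule finite_subset)
  show "range (\<lambda>\<chi>. card (rainbow s \<chi>)) \<subseteq> {..card ({..s} \<times> {..s} \<times> {..s})}"
    by (intro image_subsetI, unfold atMost_iff, intro card_mono rainbow_subset) simp
qed simp

lemma F1_eq: "F1 s = Max (range (\<lambda>\<chi>. card (rainbow s \<chi>)))"
  by (simp add: F1_def rainbow_def)

text \<open>A rainbow triple a < b < c turns into the cycle a, b, c, a, because among its pairs only
  {a, c} has color \<open>Col_III\<close>. Being increasing, the triple is determined by its vertex
  set.\<close>

lemma F1_le_T: "F1 s \<le> T s"
proof -
  have "card (rainbow s \<chi>) \<le> T s" for \<chi>
  proof -
    define R where "R = {(u, v). u \<in> {1..s} \<and> v \<in> {1..s} \<and>
      (u < v \<and> \<chi> {u, v} \<noteq> Col_III \<or> v < u \<and> \<chi> {u, v} = Col_III)}"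
    have R: "tournament {1..s} R"
      by (auto simp: tournament_def irrefl_def R_def insert_commute)
    have "(\<lambda>(a, b, c). {a, b, c}) ` rainbow s \<chi> \<subseteq> cyclic_triangles R"
    proof clarify
      fix a b c assume "(a, b, c) \<in> rainbow s \<chi>"
      then have "(a, b) \<in> R" "(b, c) \<in> R" "(c, a) \<in> R"
        by (auto simp: rainbow_def R_def insert_commute)
      then show "{a, b, c} \<in> cyclic_triangles R" unfolding cyclic_triangles_def by blast
    qed
    moreover have "finite (cyclic_triangles R)"
      using cyclic_triangles_subset[OF R] by (rule finite_subset) (simp add: finite_imp_finite_nsets)
    moreover have "inj_on (\<lambda>(a, b, c). {a, b, c}) (rainbow s \<chi>)"
    proof (rule inj_onI)
      fix p q
      assume pq: "p \<in> rainbow s \<chi>" "q \<in> rainbow s \<chi>"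
        and eq: "(\<lambda>(a, b, c). {a, b, c}) p = (\<lambda>(a, b, c). {a, b, c}) q"
      obtain a b c a' b' c' where p: "p = (a, b, c)" and q: "q = (a', b', c')"
        by (cases p, cases q)
      have l: "a < b" "b < c" "a' < b'" "b' < c'" using pq by (auto simp: p q rainbow_def)
      have "[a, b, c] = [a', b', c']"
        by (rule sorted_distinct_set_unique) (use l eq in \<open>simp_all add: p q\<close>)
      then show "p = q" by (simp add: p q)
    qed
    ultimately have "card (rainbow s \<chi>) \<le> card (cyclic_triangles R)"
      by (metis card_image card_mono)
    also have "\<dots> \<le> T s"
      unfolding T_def using R by (intro Max_ge finite_tournament_counts) auto
    finally show ?thesis .
  qed
  then show ?thesis
    unfolding F1_eq using finite_rainbow_counts by (subst Max_le_iff) auto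
qed

text \<open>Three consecutive blocks of length \<open>m\<close> carry shifted copies of
  \<open>\<chi>\<close>, and the colors between the blocks make every transversal triple
  rainbow.\<close>

lemma rainbow_triple:
  "\<exists>\<chi>'. 3 * card (rainbow m \<chi>) + m ^ 3 \<le> card (rainbow (3 * m) \<chi>')"
proof -
  \<comment> \<open>Blocks are numbered 0, 1, 2; the points start at 1, hence
    \<open>x - 1\<close>.\<close>
  define blk where "blk x = (x - 1) div m" for x
  \<comment> \<open>Colorings act on sets, so the smaller and larger endpoint are recovered by
    \<open>Min\<close> and \<open>Max\<close>. The last default serves the pairs from block 0 to
    block 2.\<close>
  define \<chi>' where "\<chi>' e = (if blk (Min e) = blk (Max e) then \<chi> ((\<lambda>x. x - blk (Min e) * m) ` e)
    else if blk (Min e) = 0 \<and> blk (Max e) = 1 then Col_I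
    else if blk (Min e) = 1 then Col_II else Col_III)" for e
  let ?sh = "\<lambda>i. \<lambda>(a, b, c). (a + i * m, b + i * m, c + i * m)"
  let ?Q = "{1..m} \<times> {m+1..2*m} \<times> {2*m+1..3*m}"
  have pair: "\<chi>' {a, b} = (if blk a = blk b then \<chi> {a - blk a * m, b - blk a * m}
    else if blk a = 0 \<and> blk b = 1 then Col_I else if blk a = 1 then Col_II else Col_III)"
    if "a < b" for a b
  proof -
    have "Min {a, b} = a" "Max {a, b} = b" using that by auto
    then show ?thesis by (simp add: \<chi>'_def)
  qed
  have blk: "blk x = i" if "i * m + 1 \<le> x" "x \<le> i * m + m" for x i
    unfolding blk_def using that by (intro div_nat_eqI) (auto simp: algebra_simps)
  have Sh: "?sh i ` rainbow m \<chi> \<subseteq> rainbow (3 * m) \<chi>'" if "i < 3" for i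
  proof clarify
    fix a b c assume abc: "(a, b, c) \<in> rainbow m \<chi>"
    then have l: "1 \<le> a" "a < b" "b < c" "c \<le> m" by (auto simp: rainbow_def)
    then have "blk (a + i * m) = i" "blk (b + i * m) = i" "blk (c + i * m) = i"
      by (auto intro!: blk)
    moreover have "c + i * m \<le> 3 * m"
    proof -
      have "c + i * m \<le> Suc i * m" using l by simp
      also have "\<dots> \<le> 3 * m" using that by (intro mult_right_mono) auto
      finally show ?thesis .
    qed
    ultimately show "(a + i * m, b + i * m, c + i * m) \<in> rainbow (3 * m) \<chi>'"
      using abc l by (auto simp: rainbow_def pair)
  qed
  have Q: "?Q \<subseteq> rainbow (3 * m) \<chi>'"
  proof clarify
    fix a b c assume l: "a \<in> {1..m}" "b \<in> {m+1..2*m}" "c \<in> {2*m+1..3*m}"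
    then have "blk a = 0" "blk b = 1" "blk c = 2" by (auto intro!: blk)
    then show "(a, b, c) \<in> rainbow (3 * m) \<chi>'"
      using l by (auto simp: rainbow_def pair)
  qed
  have cs: "card (?sh i ` rainbow m \<chi>) = card (rainbow m \<chi>)" for i
    by (rule card_image) (auto simp: inj_on_def)
  have "3 * card (rainbow m \<chi>) + m ^ 3
      = card (?sh 0 ` rainbow m \<chi>) + card (?sh 1 ` rainbow m \<chi>) + card (?sh 2 ` rainbow m \<chi>) + card ?Q"
    unfolding cs by (simp add: card_cartesian_product power3_eq_cube)
  also have "\<dots> = card (?sh 0 ` rainbow m \<chi> \<union> ?sh 1 ` rainbow m \<chi> \<union> ?sh 2 ` rainbow m \<chi> \<union> ?Q)"
    using finite_rainbow[of m \<chi>]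
    by (subst card_Un_disjoint; (subst card_Un_disjoint)?; (subst card_Un_disjoint)?)
      (auto simp: rainbow_def)
  also have "\<dots> \<le> card (rainbow (3 * m) \<chi>')"
    using Sh[of 0] Sh[of 1] Sh[of 2] Q finite_rainbow by (intro card_mono) auto
  finally show ?thesis by blast
qed

lemma tri_le_F1: "tri j \<le> F1 (3 ^ j)"
proof -
  have "\<exists>\<chi>. tri j \<le> card (rainbow (3 ^ j) \<chi>)"
  proof (induction j)
    case (Suc j)
    then obtain \<chi> where "tri j \<le> card (rainbow (3 ^ j) \<chi>)" by blast
    moreover obtain \<chi>' where "3 * card (rainbow (3 ^ j) \<chi>) + (3 ^ j) ^ 3 \<le> card (rainbow (3 * 3 ^ j) \<chi>')"
      using rainbow_triple by blast
    ultimately show ?case by (intro exI[of _ \<chi>']) simp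
  qed simp
  then obtain \<chi> where "tri j \<le> card (rainbow (3 ^ j) \<chi>)" by blast
  also have "\<dots> \<le> F1 (3 ^ j)"
    unfolding F1_eq by (intro Max_ge finite_rainbow_counts) auto
  finally show ?thesis .
qed

section \<open>Blue triples in the absence of large red sets\<close>

text \<open>The total of \<open>f\<close> is at least \<open>card A * b / K\<close>. Elements with
  values below \<open>b / (2 * K)\<close> supply at most half of it, and each of the others supplies
  at most \<open>b\<close>.\<close>

lemma card_popular:
  fixes f :: "'a \<Rightarrow> nat"
  assumes fin: "finite A" and le: "\<And>x. x \<in> A \<Longrightarrow> f x \<le> b" and b: "0 < b"
    and dense: "card A * b \<le> K * sum f A"
  shows "card A \<le> 2 * K * card {x \<in> A. b \<le> 2 * K * f x}"
proof -
  let ?G = "{x \<in> A. b \<le> 2 * K * f x}"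
  \<comment> \<open>A popular element is bounded by the first summand, an unpopular one by the
    second.\<close>
  have "2 * K * f x \<le> 2 * K * (if x \<in> ?G then b else 0) + b" if "x \<in> A" for x
    using le[OF that] that by (auto intro!: trans_le_add1)
  then have "(\<Sum>x\<in>A. 2 * K * f x) \<le> (\<Sum>x\<in>A. 2 * K * (if x \<in> ?G then b else 0) + b)"
    by (rule sum_mono)
  also have "\<dots> = 2 * K * (card ?G * b) + card A * b"
    using fin by (simp add: sum.distrib sum_distrib_left[symmetric] sum.If_cases Int_def)
  finally have "2 * (K * sum f A) \<le> 2 * K * (card ?G * b) + card A * b"
    by (simp add: sum_distrib_left mult.assoc)
  then have "card A * b \<le> (2 * K * card ?G) * b" 
    using dense by (simp only: mult.assoc)
  then show ?thesis using b by simp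
qed

text \<open>
  Restricting to a set \<open>W\<close> of bounded size before choosing the sets \<open>X\<close> leaves only boundedly many
  candidates for the pigeonhole principle.
\<close>

lemma common_neighbourhood:
  fixes V :: "'a set" and Y :: "'b set"
  assumes fin: "finite V" "finite Y" and E: "E \<subseteq> V \<times> Y"
    and dense: "card V * card Y \<le> K * card E"
    and K: "0 < K" and M: "0 < M" and large: "8 * K ^ 2 * M \<le> card V"
    and P: "\<And>W. W \<subseteq> V \<Longrightarrow> M \<le> card W \<Longrightarrow> \<exists>X\<subseteq>W. card X = m \<and> P X"
  obtains X where "X \<subseteq> V" "card X = m" "P X"
    "card Y \<le> 4 * K * (4 * K * M) ^ m * card {y \<in> Y. \<forall>x\<in>X. (x, y) \<in> E}"
proof (cases "Y = {}")
  case True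
  have "M \<le> 8 * K ^ 2 * M" using K by simp
  then have "M \<le> card V" using large by (rule order_trans)
  with P[of V] True that show ?thesis by auto
next
  case False
  \<comment> \<open>Vertices related to at least a fraction 1 / (2K) of \<open>Y\<close>.\<close>
  define V' where "V' = {v \<in> V. card Y \<le> 2 * K * card {y \<in> Y. (v, y) \<in> E}}"
  \<comment> \<open>Chosen so that a fraction 1 / (4K) of a \<open>w\<close>-set still has
    \<open>M\<close> elements, enough for \<open>P\<close>. Since \<open>2 * K * w\<close> is
    \<open>8 * K ^ 2 * M\<close>, the set \<open>V'\<close> is large enough to contain such a
    \<open>w\<close>-set.\<close>
  define w where "w = 4 * K * M"
  have "E = (SIGMA v:V. {y \<in> Y. (v, y) \<in> E})" using E by auto
  then have "card E = (\<Sum>v\<in>V. card {y \<in> Y. (v, y) \<in> E})"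
    using fin by (subst card_SigmaI[symmetric]) auto
  then have "card V \<le> 2 * K * card V'"
    unfolding V'_def using fin dense False
    by (intro card_popular) (auto intro: card_mono)
  moreover have "2 * K * w = 8 * K ^ 2 * M" by (simp add: w_def power2_eq_square)
  ultimately have "2 * K * w \<le> 2 * K * card V'" using large by linarith
  then have "w \<le> card V'" using K by simp
  then obtain W where W: "W \<subseteq> V'" "card W = w" "finite W"
    by (rule obtain_subset_with_card_n)
  have WV: "W \<subseteq> V" using W V'_def by auto
  define N where "N y = {x \<in> W. (x, y) \<in> E}" for y
  define Y' where "Y' = {y \<in> Y. w \<le> 2 * (2 * K) * card (N y)}"
  have "card Y * w = (\<Sum>x\<in>W. card Y)" using W by simp
  also have "\<dots> \<le> (\<Sum>x\<in>W. 2 * K * card {y \<in> Y. (x, y) \<in> E})"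
    using W by (intro sum_mono) (auto simp: V'_def)
  also have "\<dots> = 2 * K * (\<Sum>x\<in>W. card {y \<in> Y. (x, y) \<in> E})"
    by (simp add: sum_distrib_left)
  also have "(\<Sum>x\<in>W. card {y \<in> Y. (x, y) \<in> E}) = card (SIGMA x:W. {y \<in> Y. (x, y) \<in> E})"
    using fin W by simp
  also have "\<dots> = card (SIGMA y:Y. N y)"
    by (rule bij_betw_same_card[of prod.swap]) (auto simp: bij_betw_def N_def inj_on_def image_iff)
  also have "\<dots> = (\<Sum>y\<in>Y. card (N y))"
    using fin W by (simp add: N_def)
  \<comment> \<open>Second averaging, with the sides exchanged: between \<open>W\<close> and
    \<open>Y\<close> the density is at least 1 / (2K), so \<open>2 * K\<close> takes the place of
    \<open>K\<close>.\<close>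
  finally have "card Y \<le> 2 * (2 * K) * card Y'"
    unfolding Y'_def using fin W K M
    by (intro card_popular) (auto simp: N_def w_def intro: card_mono[of W, simplified W(2) w_def])
  moreover
  have "\<exists>X\<subseteq>N y. card X = m \<and> P X" if "y \<in> Y'" for y
  proof (rule P)
    show "N y \<subseteq> V" using WV by (auto simp: N_def)
    have "4 * K * M \<le> 4 * K * card (N y)" using that by (simp add: Y'_def w_def)
    then show "M \<le> card (N y)" using K by simp
  qed
  then obtain X where X: "\<And>y. y \<in> Y' \<Longrightarrow> X y \<subseteq> N y \<and> card (X y) = m \<and> P (X y)" by metis
  define Z where "Z X = {y \<in> Y. \<forall>x\<in>X. (x, y) \<in> E}" for X
  have finY': "finite Y'" using fin by (simp add: Y'_def)
  have "Y' \<noteq> {}"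
  proof
    assume "Y' = {}"
    with \<open>card Y \<le> 2 * (2 * K) * card Y'\<close> have "card Y = 0" by simp
    with False fin show False by simp
  qed
  \<comment> \<open>Pigeonhole: each \<open>y\<close> in \<open>Y'\<close> lies in
    \<open>Z (X y)\<close>, and at most \<open>w ^ m\<close> different sets \<open>X y\<close>
    occur, all being \<open>m\<close>-subsets of \<open>W\<close>.\<close>
  have "\<exists>A \<in> X ` Y'. card Y' \<le> card (Z A) * w ^ m"
  proof (rule ccontr)
    assume "\<not> ?thesis"
    then have small: "card (Z A) * w ^ m < card Y'" if "A \<in> X ` Y'" for A using that by force
    have "X ` Y' \<subseteq> [W]\<^bsup>m\<^esup>"
      using X W by (auto simp: nsets_def N_def intro: finite_subset)
    then have "card (X ` Y') \<le> card ([W]\<^bsup>m\<^esup>)"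
      using W by (intro card_mono finite_imp_finite_nsets)
    also have "\<dots> \<le> w ^ m" using W by (cases "m \<le> w") (auto intro: binomial_le_pow simp: binomial_eq_0)
    finally have im: "card (X ` Y') \<le> w ^ m" .
    have "Y' \<subseteq> (\<Union>A\<in>X ` Y'. Z A)" using X by (fastforce simp: Z_def N_def Y'_def)
    then have "card Y' \<le> card (\<Union>A\<in>X ` Y'. Z A)"
      using finY' fin by (intro card_mono) (auto simp: Z_def)
    also have "\<dots> \<le> (\<Sum>A\<in>X ` Y'. card (Z A))"
      using finY' by (intro card_UN_le) auto
    finally have "card Y' * w ^ m \<le> (\<Sum>A\<in>X ` Y'. card (Z A) * w ^ m)"
      by (simp add: sum_distrib_right[symmetric])
    also have "\<dots> < (\<Sum>A\<in>X ` Y'. card Y')"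
      using finY' \<open>Y' \<noteq> {}\<close> small by (intro sum_strict_mono) auto
    also have "\<dots> \<le> w ^ m * card Y'" using im by simp
    finally show False by (simp add: mult.commute)
  qed
  then obtain y where y: "y \<in> Y'" and le: "card Y' \<le> card (Z (X y)) * w ^ m" by auto
  show ?thesis
  proof (rule that)
    show "X y \<subseteq> V" using X[OF y] WV by (auto simp: N_def)
    have "card Y \<le> 4 * K * card Y'" using \<open>card Y \<le> 2 * (2 * K) * card Y'\<close> by simp
    also have "\<dots> \<le> 4 * K * (card (Z (X y)) * w ^ m)" using le by simp
    finally show "card Y \<le> 4 * K * (4 * K * M) ^ m * card {z \<in> Y. \<forall>x\<in>X y. (x, z) \<in> E}"
      by (simp add: Z_def w_def ac_simps)
  qed (use X[OF y] in auto)
qed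

section \<open>Counting blue triples\<close>

text \<open>Double counting of pairs of a blue triple and an \<open>n\<close>-set around it: every
  \<open>n\<close>-set occurs, and a triple lies in at most
  \<open>(card V - 3) choose (n - 3)\<close> of them.\<close>

lemma card_blue_ge:
  assumes fin: "finite V" and n: "n \<le> card V"
    and ind: "\<And>A. A \<in> [V]\<^bsup>n\<^esup> \<Longrightarrow> \<exists>e\<in>[A]\<^bsup>3\<^esup>. e \<in> B"
  shows "card V choose 3 \<le> (n choose 3) * card {e \<in> [V]\<^bsup>3\<^esup>. e \<in> B}"
proof -
  let ?B = "{e \<in> [V]\<^bsup>3\<^esup>. e \<in> B}"
  obtain A where A: "A \<subseteq> V" "card A = n" "finite A" using n by (rule obtain_subset_with_card_n)
  then have "A \<in> [V]\<^bsup>n\<^esup>" by (auto simp: nsets_def)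
  from ind[OF this] obtain e where "e \<subseteq> A" "card e = 3" by (auto simp: nsets_def)
  with A have n3: "3 \<le> n" by (metis card_mono)
  have finB: "finite ?B" using fin by (simp add: finite_imp_finite_nsets)
  have "card {A \<in> [V]\<^bsup>n\<^esup>. e \<subseteq> A} \<le> (card V - 3) choose (n - 3)" if "e \<in> ?B" for e
  proof -
    have e: "e \<subseteq> V" "card e = 3" "finite e" using that by (auto simp: nsets_def)
    have "card {A \<in> [V]\<^bsup>n\<^esup>. e \<subseteq> A} = card ((\<lambda>A. A - e) ` {A \<in> [V]\<^bsup>n\<^esup>. e \<subseteq> A})"
      by (rule card_image[symmetric]) (auto simp: inj_on_def)
    also have "\<dots> \<le> card ([V - e]\<^bsup>(n - 3)\<^esup>)"
      using fin e by (intro card_mono) (auto simp: finite_imp_finite_nsets nsets_def card_Diff_subset)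
    also have "\<dots> = (card V - 3) choose (n - 3)" using fin e by (simp add: card_Diff_subset)
    finally show ?thesis .
  qed
  then have "(\<Sum>e\<in>?B. card {A \<in> [V]\<^bsup>n\<^esup>. e \<subseteq> A}) \<le> (\<Sum>e\<in>?B. (card V - 3) choose (n - 3))"
    by (rule sum_mono)
  moreover have "card ([V]\<^bsup>n\<^esup>) \<le> card (\<Union>e\<in>?B. {A \<in> [V]\<^bsup>n\<^esup>. e \<subseteq> A})"
  proof (rule card_mono)
    show "[V]\<^bsup>n\<^esup> \<subseteq> (\<Union>e\<in>?B. {A \<in> [V]\<^bsup>n\<^esup>. e \<subseteq> A})"
    proof
      fix A assume A: "A \<in> [V]\<^bsup>n\<^esup>"
      from ind[OF A] obtain e where "e \<in> [A]\<^bsup>3\<^esup>" "e \<in> B" by blast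
      with A show "A \<in> (\<Union>e\<in>?B. {A \<in> [V]\<^bsup>n\<^esup>. e \<subseteq> A})" by (auto simp: nsets_def)
    qed
  qed (use fin finB in \<open>auto simp: finite_imp_finite_nsets\<close>)
  moreover have "card (\<Union>e\<in>?B. {A \<in> [V]\<^bsup>n\<^esup>. e \<subseteq> A}) \<le> (\<Sum>e\<in>?B. card {A \<in> [V]\<^bsup>n\<^esup>. e \<subseteq> A})"
    using finB by (rule card_UN_le)
  ultimately have "card V choose n \<le> card ?B * ((card V - 3) choose (n - 3))"
    by simp
  then have "(card V choose n) * (n choose 3) \<le> card ?B * ((card V - 3) choose (n - 3)) * (n choose 3)"
    by (rule mult_right_mono) simp
  moreover have "(card V choose n) * (n choose 3) = (card V choose 3) * ((card V - 3) choose (n - 3))"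
    using n3 n by (rule choose_mult)
  ultimately have "(card V choose 3) * ((card V - 3) choose (n - 3))
      \<le> ((n choose 3) * card ?B) * ((card V - 3) choose (n - 3))"
    by (simp add: ac_simps)
  moreover have "0 < (card V - 3) choose (n - 3)" using n n3 by simp
  ultimately show ?thesis by (simp only: mult_le_cancel2)
qed

text \<open>Ordered triples form a relation between \<open>V\<close> and
  \<open>V \<times> V\<close>, to which \<open>common_neighbourhood\<close> applies. The factor 27
  comes from N choose 3 being at least (N / 3)^3; the gain from the six orderings is given
  away.\<close>

lemma card_ordered_blue_ge:
  assumes fin: "finite V" and n: "n \<le> card V"
    and ind: "\<And>A. A \<in> [V]\<^bsup>n\<^esup> \<Longrightarrow> \<exists>e\<in>[A]\<^bsup>3\<^esup>. e \<in> B"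
  shows "card V ^ 3 \<le> 27 * n ^ 3 *
    card {(x, y, z). x \<in> V \<and> y \<in> V \<and> z \<in> V \<and> card {x, y, z} = 3 \<and> {x, y, z} \<in> B}"
    (is "_ \<le> _ * card ?E")
proof (cases "3 \<le> card V")
  case True
  have finE: "finite ?E"
    by (rule finite_subset[of _ "V \<times> V \<times> V"]) (use fin in auto)
  have "{e \<in> [V]\<^bsup>3\<^esup>. e \<in> B} \<subseteq> (\<lambda>(x, y, z). {x, y, z}) ` ?E"
  proof clarify
    fix e assume e: "e \<in> [V]\<^bsup>3\<^esup>" "e \<in> B"
    then have "card e = 3" by (auto simp: nsets_def)
    then obtain x y z where "e = {x, y, z}" by (auto simp: card_3_iff)
    with e have "(x, y, z) \<in> ?E" by (auto simp: nsets_def)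
    with \<open>e = {x, y, z}\<close> show "e \<in> (\<lambda>(x, y, z). {x, y, z}) ` ?E" by force
  qed
  then have BE: "card {e \<in> [V]\<^bsup>3\<^esup>. e \<in> B} \<le> card ?E"
    using finE by (rule surj_card_le[rotated])
  have "(real (card V) / real 3) ^ 3 \<le> real (card V choose 3)"
    using True by (rule binomial_ge_n_over_k_pow_k)
  then have "real (card V ^ 3) \<le> real (27 * (card V choose 3))"
    by (simp add: power_divide)
  then have "card V ^ 3 \<le> 27 * (card V choose 3)" by (simp only: of_nat_le_iff)
  also have "\<dots> \<le> 27 * ((n choose 3) * card {e \<in> [V]\<^bsup>3\<^esup>. e \<in> B})"
    using card_blue_ge[OF fin n ind] by simp
  also have "\<dots> \<le> 27 * (n ^ 3 * card ?E)"
    proof -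
    have "n choose 3 \<le> n ^ 3"
      by (cases "3 \<le> n") (auto intro: binomial_le_pow simp: binomial_eq_0)
    then show ?thesis using BE by (intro mult_left_mono mult_mono) auto
  qed
  finally show ?thesis by simp
next
  \<comment> \<open>This case is contradictory: some \<open>n\<close>-subset of \<open>V\<close>
    contains a triple.\<close>
  case False
  obtain A where A: "A \<subseteq> V" "card A = n" "finite A" using n by (rule obtain_subset_with_card_n)
  then have "A \<in> [V]\<^bsup>n\<^esup>" by (auto simp: nsets_def)
  from ind[OF this] obtain e where "e \<subseteq> A" "card e = 3" by (auto simp: nsets_def)
  with A fin have "3 \<le> card V" by (metis card_mono order_trans)
  with False show ?thesis by simp
qed

text \<open>The triples inside each part and the transversal ones form four disjoint families, which
  reproduces the recursion of \<open>tri\<close>.\<close>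

lemma blue_tripartite:
  assumes c: "card X = m" "card Y = m" "card Z = m" "0 < m"
    and t: "t \<le> card {e \<in> [X]\<^bsup>3\<^esup>. e \<in> B}" "t \<le> card {e \<in> [Y]\<^bsup>3\<^esup>. e \<in> B}" "t \<le> card {e \<in> [Z]\<^bsup>3\<^esup>. e \<in> B}"
    and blue: "\<And>x y z. x \<in> X \<Longrightarrow> y \<in> Y \<Longrightarrow> z \<in> Z \<Longrightarrow> card {x, y, z} = 3 \<and> {x, y, z} \<in> B"
  shows "card (X \<union> Y \<union> Z) = 3 * m" "3 * t + m ^ 3 \<le> card {e \<in> [X \<union> Y \<union> Z]\<^bsup>3\<^esup>. e \<in> B}"
proof -
  have fin: "finite X" "finite Y" "finite Z" using c by (auto intro: card_ge_0_finite)
  \<comment> \<open>Nonempty parts are what makes disjointness follow from \<open>blue\<close>: a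
    common point of two parts, completed by any point of the third, would give fewer than three
    vertices.\<close>
  have ne: "X \<noteq> {}" "Y \<noteq> {}" "Z \<noteq> {}" using c by auto
  have dist: "x \<noteq> y \<and> y \<noteq> z \<and> x \<noteq> z" if "x \<in> X" "y \<in> Y" "z \<in> Z" for x y z
    using blue[OF that] by (auto simp: card_insert_if split: if_splits)
  have disj: "X \<inter> Y = {}" "Y \<inter> Z = {}" "X \<inter> Z = {}" using dist ne by blast+
  then show "card (X \<union> Y \<union> Z) = 3 * m"
    using fin c by (simp add: card_Un_disjoint Int_Un_distrib2)
  let ?B = "\<lambda>X. {e \<in> [X]\<^bsup>3\<^esup>. e \<in> B}"
  let ?h = "\<lambda>(x, y, z). {x, y, z}"
  let ?Q = "?h ` (X \<times> Y \<times> Z)"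
  have inj: "inj_on ?h (X \<times> Y \<times> Z)"
  proof (rule inj_onI)
    fix p q assume pq: "p \<in> X \<times> Y \<times> Z" "q \<in> X \<times> Y \<times> Z" and eq: "?h p = ?h q"
    obtain x y z x' y' z' where p: "p = (x, y, z)" and q: "q = (x', y', z')"
      by (cases p, cases q)
    have "x' \<in> {x, y, z}" "y' \<in> {x, y, z}" "z' \<in> {x, y, z}"
      using eq unfolding p q by auto
    moreover have "x' \<notin> Y \<union> Z" "y' \<notin> X \<union> Z" "z' \<notin> X \<union> Y"
      using pq disj unfolding p q by auto
    ultimately show "p = q" using pq unfolding p q by auto
  qed
  have cQ: "card ?Q = m ^ 3"
    using inj c by (simp add: card_image card_cartesian_product power3_eq_cube)
  have finB: "finite (?B X)" "finite (?B Y)" "finite (?B Z)" "finite ?Q"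
    using fin by (auto simp: finite_imp_finite_nsets)
  have sep: "[X]\<^bsup>3\<^esup> \<inter> [Y]\<^bsup>3\<^esup> = {}" if "X \<inter> Y = {}" for X Y :: "'a set"
  proof -
    have "[X]\<^bsup>3\<^esup> \<inter> [Y]\<^bsup>3\<^esup> \<subseteq> [X \<inter> Y]\<^bsup>3\<^esup>" by (auto simp: nsets_def)
    also have "\<dots> = {}" unfolding that by (auto simp: nsets_def)
    finally show ?thesis by blast
  qed
  have sepQ: "?Q \<inter> [X]\<^bsup>3\<^esup> = {}" "?Q \<inter> [Y]\<^bsup>3\<^esup> = {}" "?Q \<inter> [Z]\<^bsup>3\<^esup> = {}"
    using disj by (auto simp: nsets_def)
  have "3 * t + m ^ 3 \<le> card (?B X) + card (?B Y) + card (?B Z) + card ?Q" using t cQ by simp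
  also have "\<dots> = card (?B X \<union> ?B Y) + card (?B Z) + card ?Q"
    using finB sep[OF disj(1)] by (subst card_Un_disjoint) auto
  also have "\<dots> = card (?B X \<union> ?B Y \<union> ?B Z) + card ?Q"
    using finB sep[OF disj(2)] sep[OF disj(3)] by (subst card_Un_disjoint[of "_ \<union> _"]) auto
  also have "\<dots> = card (?B X \<union> ?B Y \<union> ?B Z \<union> ?Q)"
  proof (rule card_Un_disjoint[symmetric])
    show "(?B X \<union> ?B Y \<union> ?B Z) \<inter> ?Q = {}" using sepQ by blast
  qed (use finB in auto)
  also have "\<dots> \<le> card (?B (X \<union> Y \<union> Z))"
    using fin blue by (intro card_mono) (auto simp: finite_imp_finite_nsets nsets_def)
  finally show "3 * t + m ^ 3 \<le> card (?B (X \<union> Y \<union> Z))" .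
qed

section \<open>Polynomial bounds and the embedding of the iterated construction\<close>

text \<open>From 2 on, constant factors can be absorbed into the exponent, so that a pure power
  suffices.\<close>

definition poly_bounded :: "(nat \<Rightarrow> nat) \<Rightarrow> bool" where
  "poly_bounded f \<longleftrightarrow> (\<exists>D. \<forall>n\<ge>2. f n \<le> n ^ D)"

lemma poly_bounded_const: "poly_bounded (\<lambda>_. c)"
  unfolding poly_bounded_def
proof (intro exI allI impI)
  fix n :: nat assume "2 \<le> n"
  have "c \<le> 2 ^ c" by simp
  also have "\<dots> \<le> n ^ c" using \<open>2 \<le> n\<close> by (rule power_mono) simp
  finally show "c \<le> n ^ c" .
qed

lemma poly_bounded_id: "poly_bounded (\<lambda>n. n)"
  unfolding poly_bounded_def by (rule exI[of _ 1]) simp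

lemma poly_bounded_mult:
  assumes "poly_bounded f" "poly_bounded g"
  shows "poly_bounded (\<lambda>n. f n * g n)"
proof -
  obtain a b where "\<forall>n\<ge>2. f n \<le> n ^ a" "\<forall>n\<ge>2. g n \<le> n ^ b"
    using assms unfolding poly_bounded_def by blast
  then have "\<forall>n\<ge>2. f n * g n \<le> n ^ (a + b)" by (auto simp: power_add intro: mult_mono)
  then show ?thesis unfolding poly_bounded_def by blast
qed

lemma poly_bounded_power: "poly_bounded f \<Longrightarrow> poly_bounded (\<lambda>n. f n ^ k)"
  by (induction k) (auto intro: poly_bounded_mult poly_bounded_const)

lemma poly_bounded_add:
  assumes "poly_bounded f" "poly_bounded g"
  shows "poly_bounded (\<lambda>n. f n + g n)"
proof -
  obtain a b where ab: "\<forall>n\<ge>2. f n \<le> n ^ a" "\<forall>n\<ge>2. g n \<le> n ^ b"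
    using assms unfolding poly_bounded_def by blast
  have "f n + g n \<le> n ^ (a + b + 1)" if "2 \<le> n" for n
  proof -
    have "n ^ a \<le> n ^ (a + b)" "n ^ b \<le> n ^ (a + b)"
      using that by (auto intro!: power_increasing)
    then have "f n + g n \<le> 2 * n ^ (a + b)" using ab that by (metis add_mono mult_2 order_trans)
    also have "\<dots> \<le> n ^ (a + b + 1)" using that by simp
    finally show ?thesis .
  qed
  then show ?thesis unfolding poly_bounded_def by blast
qed

lemmas poly_bounded_intros =
  poly_bounded_const poly_bounded_id poly_bounded_mult poly_bounded_power poly_bounded_add

text \<open>The exponent depends on \<open>j\<close> alone, so the induction hypothesis can be
  applied to all large subsets of \<open>V\<close> with the same \<open>n\<close> and
  \<open>B\<close>.\<close>

lemma tri_blue_in_large_set: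
  "\<exists>D. \<forall>n\<ge>2. \<forall>(V :: 'a set) B. finite V \<longrightarrow> n ^ D \<le> card V \<longrightarrow>
     (\<forall>A\<in>[V]\<^bsup>n\<^esup>. \<exists>e\<in>[A]\<^bsup>3\<^esup>. e \<in> B) \<longrightarrow>
     (\<exists>X\<subseteq>V. card X = 3 ^ j \<and> tri j \<le> card {e \<in> [X]\<^bsup>3\<^esup>. e \<in> B})"
proof (induction j)
  case 0
  have "\<exists>X\<subseteq>V. card X = 1" if "1 \<le> card V" for V :: "'a set"
    using that by (metis obtain_subset_with_card_n)
  then show ?case by (intro exI[of _ 0]) simp
next
  case (Suc j)
  define m where "m = (3 :: nat) ^ j"
  obtain d where d: "\<forall>n\<ge>2. \<forall>(V :: 'a set) B. finite V \<longrightarrow> n ^ d \<le> card V \<longrightarrow>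
     (\<forall>A\<in>[V]\<^bsup>n\<^esup>. \<exists>e\<in>[A]\<^bsup>3\<^esup>. e \<in> B) \<longrightarrow>
     (\<exists>X\<subseteq>V. card X = 3 ^ j \<and> tri j \<le> card {e \<in> [X]\<^bsup>3\<^esup>. e \<in> B})"
    using Suc.IH ..
  note d = d[rule_format, folded m_def]
  \<comment> \<open>Reciprocal densities: \<open>K0\<close> for the ordered blue triples,
    \<open>K1\<close> for the pairs completing all of \<open>X\<close>, \<open>K2\<close> for the
    points completing all of \<open>X\<close> and \<open>Y\<close>.\<close>
  define K0 where "K0 n = 27 * n ^ 3" for n :: nat
  define K1 where "K1 n = 4 * K0 n * (4 * K0 n * n ^ d) ^ m" for n
  define K2 where "K2 n = 4 * K1 n * (4 * K1 n * n ^ d) ^ m" for n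
  \<comment> \<open>The four summands are the size requirements: an \<open>n\<close>-subset must
    exist, two calls of \<open>common_neighbourhood\<close> need room, and the last common
    neighbourhood must have \<open>n ^ d\<close> points.\<close>
  have "poly_bounded (\<lambda>n. n + 8 * K0 n ^ 2 * n ^ d + 8 * K1 n ^ 2 * n ^ d + K2 n * n ^ d)"
    unfolding K2_def K1_def K0_def by (intro poly_bounded_intros)
  then obtain D where D: "\<And>n. 2 \<le> n \<Longrightarrow>
      n + 8 * K0 n ^ 2 * n ^ d + 8 * K1 n ^ 2 * n ^ d + K2 n * n ^ d \<le> n ^ D"
    unfolding poly_bounded_def by blast
  show ?case
  proof (rule exI[of _ D], intro allI impI)
    fix n :: nat and V :: "'a set" and B
    assume n: "2 \<le> n" and fin: "finite V" and V: "n ^ D \<le> card V"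
      and ind: "\<forall>A\<in>[V]\<^bsup>n\<^esup>. \<exists>e\<in>[A]\<^bsup>3\<^esup>. e \<in> B"
    let ?P = "\<lambda>X. tri j \<le> card {e \<in> [X]\<^bsup>3\<^esup>. e \<in> B}"
    have large: "n \<le> card V" "8 * K0 n ^ 2 * n ^ d \<le> card V" "8 * K1 n ^ 2 * n ^ d \<le> card V"
      "K2 n * n ^ d \<le> card V"
      using D[OF n] V by linarith+
    have pos: "0 < K0 n" "0 < K1 n" "0 < K2 n" "0 < n ^ d"
      using n by (auto simp: K0_def K1_def K2_def)
    \<comment> \<open>Having a blue triple in every \<open>n\<close>-set passes to subsets, so the
      induction hypothesis supplies \<open>P\<close> in \<open>common_neighbourhood\<close>.\<close>
    have good: "\<exists>X\<subseteq>W. card X = m \<and> ?P X" if "W \<subseteq> V" "n ^ d \<le> card W" for W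
    proof (rule d[OF n _ that(2)])
      fix A assume "A \<in> [W]\<^bsup>n\<^esup>"
      then have "A \<in> [V]\<^bsup>n\<^esup>" using that by (auto simp: nsets_def)
      then show "\<exists>e\<in>[A]\<^bsup>3\<^esup>. e \<in> B" using ind by blast
    qed (use that fin finite_subset in auto)
    define E where "E = {(x, y, z). x \<in> V \<and> y \<in> V \<and> z \<in> V \<and> card {x, y, z} = 3 \<and> {x, y, z} \<in> B}"
    have E: "card V * card (V \<times> V) \<le> K0 n * card E"
      using card_ordered_blue_ge[OF fin large(1) bspec[OF ind]]
      by (simp add: K0_def E_def card_cartesian_product power3_eq_cube mult.assoc)
    \<comment> \<open>The first vertex of the triples is blown up to \<open>X\<close>, keeping many
      pairs for the other two.\<close>
    obtain X where X: "X \<subseteq> V" "card X = m" "?P X"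
      and cX: "card (V \<times> V) \<le> K1 n * card {p \<in> V \<times> V. \<forall>x\<in>X. (x, p) \<in> E}"
      unfolding K1_def
      by (rule common_neighbourhood[OF fin _ _ E pos(1,4) large(2) good])
        (use fin in \<open>auto simp: E_def\<close>)
    let ?E' = "{p \<in> V \<times> V. \<forall>x\<in>X. (x, p) \<in> E}"
    have E': "card V * card V \<le> K1 n * card ?E'"
      using cX by (simp only: card_cartesian_product)
    \<comment> \<open>The same for the second vertex, within the pairs that survived.\<close>
    obtain Y where Y: "Y \<subseteq> V" "card Y = m" "?P Y"
      and cY: "card V \<le> K2 n * card {z \<in> V. \<forall>y\<in>Y. (y, z) \<in> ?E'}"
      unfolding K2_def
      by (rule common_neighbourhood[OF fin fin _ E' pos(2,4) large(3) good]) auto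
    let ?Z = "{z \<in> V. \<forall>y\<in>Y. (y, z) \<in> ?E'}"
    \<comment> \<open>The third vertex needs no pigeonholing: the induction hypothesis applies
      inside \<open>?Z\<close> itself.\<close>
    have "K2 n * n ^ d \<le> K2 n * card ?Z" using large(4) cY by (rule order_trans)
    then have "n ^ d \<le> card ?Z" using pos by simp
    with good[of ?Z] obtain Z where Z: "Z \<subseteq> ?Z" "card Z = m" "?P Z" by auto
    have "card {x, y, z} = 3 \<and> {x, y, z} \<in> B" if "x \<in> X" "y \<in> Y" "z \<in> Z" for x y z
      using that Z(1) by (auto simp: E_def)
    note * = blue_tripartite[OF X(2) Y(2) Z(2) _ X(3) Y(3) Z(3) this]
    have "X \<union> Y \<union> Z \<subseteq> V" using X Y Z by auto
    moreover have "card (X \<union> Y \<union> Z) = 3 ^ Suc j" using *(1) by (simp add: m_def)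
    moreover have "tri (Suc j) \<le> card {e \<in> [X \<union> Y \<union> Z]\<^bsup>3\<^esup>. e \<in> B}"
      using *(2) by (simp add: m_def)
    ultimately show "\<exists>X\<subseteq>V. card X = 3 ^ Suc j \<and> tri (Suc j) \<le> card {e \<in> [X]\<^bsup>3\<^esup>. e \<in> B}"
      by blast
  qed
qed

section \<open>Random tournaments\<close>

text \<open>Pairs u < v in \<open>S\<close> point upwards, all others downwards. Every
  \<open>S\<close> yields a tournament, so a random tournament becomes a random set of increasing
  pairs.\<close>

definition orient :: "nat \<Rightarrow> (nat \<times> nat) set \<Rightarrow> (nat \<times> nat) set" where
  "orient N S = {(u, v). u \<in> {1..N} \<and> v \<in> {1..N} \<and>
     (u < v \<and> (u, v) \<in> S \<or> v < u \<and> (v, u) \<notin> S)}"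

lemma tournament_orient: "tournament {1..N} (orient N S)"
  by (auto simp: tournament_def irrefl_def orient_def)

text \<open>Insertion sort: a new vertex goes between its in-neighbours and its out-neighbours. An
  arc from an out-neighbour back to an in-neighbour would close a cyclic triangle.\<close>

lemma transitive_tournament_sorted:
  assumes "finite A" "tournament V R" "A \<subseteq> V" "[A]\<^bsup>3\<^esup> \<inter> cyclic_triangles R = {}"
  shows "\<exists>xs. set xs = A \<and> distinct xs \<and> sorted_wrt (\<lambda>x y. (x, y) \<in> R) xs"
  using assms(1,3,4)
proof (induction A rule: finite_induct)
  case (insert a A)
  note total = tournament_total[OF assms(2)] and asym = tournament_asym[OF assms(2)]
  have "[A]\<^bsup>3\<^esup> \<subseteq> [insert a A]\<^bsup>3\<^esup>" by (rule nsets_mono) auto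
  then obtain xs where xs: "set xs = A" "distinct xs" "sorted_wrt (\<lambda>x y. (x, y) \<in> R) xs"
    using insert by blast
  let ?l = "filter (\<lambda>x. (x, a) \<in> R) xs" and ?r = "filter (\<lambda>x. (a, x) \<in> R) xs"
  have tr: "(x, y) \<in> R" if "x \<in> A" "y \<in> A" "(x, a) \<in> R" "(a, y) \<in> R" for x y
  proof (rule ccontr)
    assume n: "(x, y) \<notin> R"
    have "x \<noteq> y" using that asym by blast
    then have "(y, x) \<in> R" using n that insert.prems total by blast
    then have "{x, a, y} \<in> cyclic_triangles R"
      using that unfolding cyclic_triangles_def by blast
    moreover have "{x, a, y} \<in> [insert a A]\<^bsup>3\<^esup>"
      using that \<open>x \<noteq> y\<close> insert.hyps by (auto simp: nsets_def card_insert_if)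
    ultimately show False using insert.prems by blast
  qed
  have "(x, a) \<in> R \<or> (a, x) \<in> R" if "x \<in> A" for x
    using that total[of x a] insert.prems insert.hyps by blast
  then have "set (?l @ a # ?r) = insert a A"
    using xs by auto
  moreover have "distinct (?l @ a # ?r)"
    using xs insert.hyps asym by auto
  moreover have "sorted_wrt (\<lambda>x y. (x, y) \<in> R) (?l @ a # ?r)"
    using xs tr by (auto simp: sorted_wrt_append intro: sorted_wrt_filter)
  ultimately show ?case by blast
qed simp

text \<open>Once the trace on \<open>Q\<close> is fixed, the set is determined by its part outside
  \<open>Q\<close>.\<close>

lemma card_subsets_with_trace:
  assumes "finite P" "Q \<subseteq> P"
  shows "card {S \<in> Pow P. S \<inter> Q = Q'} \<le> 2 ^ (card P - card Q)"
proof -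
  have "card {S \<in> Pow P. S \<inter> Q = Q'} = card ((\<lambda>S. S - Q) ` {S \<in> Pow P. S \<inter> Q = Q'})"
    by (rule card_image[symmetric]) (auto simp: inj_on_def)
  also have "\<dots> \<le> card (Pow (P - Q))" using assms by (intro card_mono) auto
  also have "\<dots> = 2 ^ (card P - card Q)"
    using assms by (simp add: card_Pow card_Diff_subset finite_subset)
  finally show ?thesis .
qed

text \<open>Union bound over the possible transitive orders: a given order of \<open>n\<close>
  vertices fixes \<open>n * k\<close> arcs, and there are at most \<open>N ^ n\<close> orders, fewer
  than \<open>2 ^ (n * k)\<close>.\<close>

lemma exists_tournament_small_transitive:
  assumes N: "N < 2 ^ k"
  obtains S where "\<And>A. A \<subseteq> {1..N} \<Longrightarrow> card A = 2 * k + 1 \<Longrightarrow> [A]\<^bsup>3\<^esup> \<inter> cyclic_triangles (orient N S) \<noteq> {}"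
proof -
  \<comment> \<open>An odd size makes \<open>n choose 2\<close> equal to
    \<open>n * k\<close>.\<close>
  define n where "n = 2 * k + 1"
  define P where "P = {(u, v). u \<in> {1..N} \<and> v \<in> {1..N} \<and> u < v}"
  define L where "L = {xs. set xs \<subseteq> {1..N} \<and> length xs = n}"
  define Bad where "Bad xs = {S \<in> Pow P. distinct xs \<and> sorted_wrt (\<lambda>x y. (x, y) \<in> orient N S) xs}" for xs
  have finP: "finite P"
    by (rule finite_subset[of _ "{1..N} \<times> {1..N}"]) (auto simp: P_def)
  have finL: "finite L" unfolding L_def by (rule finite_lists_length_eq) simp
  have cBad: "card (Bad xs) * 2 ^ (n * k) \<le> 2 ^ card P" if xs: "xs \<in> L" for xs
  proof (cases "distinct xs")
    case False
    then show ?thesis by (simp add: Bad_def)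
  next
    case True
    define Q where "Q = P \<inter> set xs \<times> set xs"
    have setxs: "set xs \<subseteq> {1..N}" "length xs = n" using xs by (auto simp: L_def)
    have "bij_betw (\<lambda>(u, v). {u, v}) Q ([set xs]\<^bsup>2\<^esup>)"
      unfolding bij_betw_def
    proof
      show "inj_on (\<lambda>(u, v). {u, v}) Q"
        by (auto simp: inj_on_def Q_def P_def doubleton_eq_iff)
      show "(\<lambda>(u, v). {u, v}) ` Q = [set xs]\<^bsup>2\<^esup>"
      proof (intro equalityI subsetI)
        fix e assume "e \<in> [set xs]\<^bsup>2\<^esup>"
        then obtain u v where uv: "e = {u, v}" "u \<noteq> v" "u \<in> set xs" "v \<in> set xs"
          by (auto simp: nsets_def card_2_iff)
        show "e \<in> (\<lambda>(u, v). {u, v}) ` Q"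
        proof (cases "u < v")
          case True
          then have "(u, v) \<in> Q" using uv setxs by (auto simp: Q_def P_def)
          then show ?thesis using uv by force
        next
          case False
          then have "(v, u) \<in> Q" using uv setxs by (auto simp: Q_def P_def)
          then show ?thesis using uv by force
        qed
      qed (auto simp: Q_def P_def nsets_def)
    qed
    then have "card Q = card (set xs) choose 2"
      by (metis bij_betw_same_card card_nsets)
    also have "\<dots> = n * k"
      using True setxs by (simp add: distinct_card choose_two n_def)
    finally have cQ: "card Q = n * k" .
    have QP: "Q \<subseteq> P" by (auto simp: Q_def)
    \<comment> \<open>The trace on the pairs inside \<open>set xs\<close> that is forced when
      \<open>xs\<close> lists the vertices in transitive order.\<close>
    define Q' where "Q' = {(u, v) \<in> Q. \<exists>i j. i < j \<and> j < n \<and> xs ! i = u \<and> xs ! j = v}"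
    have "S \<inter> Q = Q'" if S: "S \<in> Bad xs" for S
    proof (intro equalityI subsetI)
      have sw: "\<And>i j. i < j \<Longrightarrow> j < n \<Longrightarrow> (xs ! i, xs ! j) \<in> orient N S"
        using S setxs by (auto simp: Bad_def sorted_wrt_iff_nth_less)
      {
        fix p assume p: "p \<in> S \<inter> Q"
        then obtain u v where uv: "p = (u, v)" "(u, v) \<in> S" "(u, v) \<in> Q" by (cases p) auto
        then have "u \<in> set xs" "v \<in> set xs" "u < v" by (auto simp: Q_def P_def)
        then obtain i j where ij: "i < n" "j < n" "xs ! i = u" "xs ! j = v"
          using setxs by (metis in_set_conv_nth)
        have "\<not> j < i"
        proof
          assume "j < i"
          then have "(v, u) \<in> orient N S" using sw ij by blast
          then show False using uv \<open>u < v\<close> by (auto simp: orient_def)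
        qed
        moreover have "i \<noteq> j" using ij \<open>u < v\<close> by auto
        ultimately have "i < j" by simp
        then show "p \<in> Q'" using uv ij by (auto simp: Q'_def)
      next
        fix p assume "p \<in> Q'"
        then obtain u v i j where uv: "p = (u, v)" "(u, v) \<in> Q" "i < j" "j < n" "xs ! i = u" "xs ! j = v"
          by (auto simp: Q'_def)
        then have "(u, v) \<in> orient N S" "u < v" using sw by (auto simp: Q_def P_def)
        then show "p \<in> S \<inter> Q" using uv by (auto simp: orient_def)
      }
    qed
    then have "Bad xs \<subseteq> {S \<in> Pow P. S \<inter> Q = Q'}" by (auto simp: Bad_def)
    then have "card (Bad xs) \<le> card {S \<in> Pow P. S \<inter> Q = Q'}"
      using finP by (intro card_mono) auto
    also have "\<dots> \<le> 2 ^ (card P - card Q)" using finP QP by (rule card_subsets_with_trace)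
    finally have "card (Bad xs) * 2 ^ (n * k) \<le> 2 ^ (card P - card Q) * 2 ^ (n * k)" by simp
    also have "\<dots> = 2 ^ card P"
      using card_mono[OF finP QP] cQ by (simp add: power_add[symmetric])
    finally show ?thesis .
  qed
  \<comment> \<open>The union bound, multiplied out to stay within natural numbers.\<close>
  have "card (\<Union>xs\<in>L. Bad xs) * 2 ^ (n * k) \<le> (\<Sum>xs\<in>L. card (Bad xs)) * 2 ^ (n * k)"
    using finL by (intro mult_right_mono card_UN_le) auto
  also have "\<dots> = (\<Sum>xs\<in>L. card (Bad xs) * 2 ^ (n * k))" by (rule sum_distrib_right)
  also have "\<dots> \<le> (\<Sum>xs\<in>L. 2 ^ card P)" using cBad by (rule sum_mono)
  also have "\<dots> = N ^ n * 2 ^ card P"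
    unfolding L_def by (simp add: card_lists_length_eq)
  also have "\<dots> < (2 ^ k) ^ n * 2 ^ card P"
    using N by (intro mult_strict_right_mono power_strict_mono) (auto simp: n_def)
  also have "\<dots> = card (Pow P) * 2 ^ (n * k)"
    using finP by (simp add: card_Pow power_mult[symmetric] mult.commute)
  finally have "card (\<Union>xs\<in>L. Bad xs) < card (Pow P)" by simp
  moreover have "finite (\<Union>xs\<in>L. Bad xs)" using finL finP by (auto simp: Bad_def)
  ultimately have "\<not> Pow P \<subseteq> (\<Union>xs\<in>L. Bad xs)" by (meson card_mono not_less)
  then obtain S where S: "S \<in> Pow P" "\<And>xs. xs \<in> L \<Longrightarrow> S \<notin> Bad xs" by blast
  show ?thesis
  proof (rule that[of S])
    fix A assume A: "A \<subseteq> {1..N}" "card A = 2 * k + 1"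
    show "[A]\<^bsup>3\<^esup> \<inter> cyclic_triangles (orient N S) \<noteq> {}"
    proof
      assume "[A]\<^bsup>3\<^esup> \<inter> cyclic_triangles (orient N S) = {}"
      moreover have "finite A" using A(1) by (rule finite_subset) simp
      ultimately obtain xs where xs: "set xs = A" "distinct xs" "sorted_wrt (\<lambda>x y. (x, y) \<in> orient N S) xs"
        using transitive_tournament_sorted[OF _ tournament_orient A(1)] by blast
      then have "xs \<in> L" using A distinct_card[of xs] by (simp add: L_def n_def)
      moreover have "S \<in> Bad xs" using xs S by (simp add: Bad_def)
      ultimately show False using S by blast
    qed
  qed
qed

section \<open>The threshold\<close>

lemma f3_antimono:
  assumes "t \<le> t'"
  shows "f3 N s t' \<le> f3 N s t"
  unfolding f3_def
proof (rule Sup_subset_mono, clarify)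
  fix n assume "f3_prop N s t' n"
  then have "f3_prop N s t n" unfolding f3_prop_def using assms by (meson order_trans)
  then show "\<exists>m. enat n = enat m \<and> f3_prop N s t m" by blast
qed

section \<open>Polylogarithmic upper bound\<close>

text \<open>With cyclic triangles blue, no \<open>3 ^ j\<close>-set reaches
  \<open>Suc (tri j)\<close> blue triples. So a red set is forced, and it contains no cyclic
  triangle.\<close>

lemma f3_upper:
  assumes "N < 2 ^ k"
  shows "f3 N (3 ^ j) (Suc (tri j)) \<le> enat (2 * k + 1)"
  unfolding f3_def
proof (rule Sup_least, clarify)
  fix n assume forced: "f3_prop N (3 ^ j) (Suc (tri j)) n"
  obtain S where S: "\<And>A. A \<subseteq> {1..N} \<Longrightarrow> card A = 2 * k + 1 \<Longrightarrow>
      [A]\<^bsup>3\<^esup> \<inter> cyclic_triangles (orient N S) \<noteq> {}"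
    using exists_tournament_small_transitive[OF assms] by blast
  let ?R = "orient N S"
  define \<chi> where "\<chi> e = (if e \<in> cyclic_triangles ?R then Blue else Red)" for e
  have few: "card {e \<in> [X]\<^bsup>3\<^esup>. \<chi> e = Blue} \<le> tri j" if "X \<in> nsets {1..N} (3 ^ j)" for X
  proof -
    have X: "X \<subseteq> {1..N}" "finite X" "card X = 3 ^ j" using that by (auto simp: nsets_def)
    \<comment> \<open>A cyclic triangle with vertices in \<open>X\<close> belongs to the restricted
      tournament, where the extremal bound applies.\<close>
    have R: "tournament X (?R \<inter> X \<times> X)"
      using tournament_orient X(1) by (rule tournament_restrict)
    have "{e \<in> [X]\<^bsup>3\<^esup>. \<chi> e = Blue} \<subseteq> cyclic_triangles (?R \<inter> X \<times> X)"
    proof clarify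
      fix e assume e: "e \<in> [X]\<^bsup>3\<^esup>" "\<chi> e = Blue"
      then have "e \<in> cyclic_triangles ?R" by (simp add: \<chi>_def split: if_splits)
      then obtain x y z where "e = {x, y, z}" "(x, y) \<in> ?R" "(y, z) \<in> ?R" "(z, x) \<in> ?R"
        by (auto simp: cyclic_triangles_def)
      moreover have "e \<subseteq> X" using e(1) by (simp add: nsets_def)
      ultimately show "e \<in> cyclic_triangles (?R \<inter> X \<times> X)"
        unfolding cyclic_triangles_def by blast
    qed
    then have "card {e \<in> [X]\<^bsup>3\<^esup>. \<chi> e = Blue} \<le> card (cyclic_triangles (?R \<inter> X \<times> X))"
      using cyclic_triangles_subset[OF R] X(2)
      by (intro card_mono) (auto intro: finite_subset finite_imp_finite_nsets)
    also have "\<dots> \<le> tri j" using R X(2,3) by (rule card_cyclic_triangles_le_tri)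
    finally show ?thesis .
  qed
  then have "\<not> (\<exists>X\<in>nsets {1..N} (3 ^ j). Suc (tri j) \<le> card {e \<in> [X]\<^bsup>3\<^esup>. \<chi> e = Blue})"
    by (simp add: Suc_le_eq not_less)
  then obtain A where A: "A \<in> [{1..N}]\<^bsup>n\<^esup>" "\<forall>e\<in>[A]\<^bsup>3\<^esup>. \<chi> e = Red"
    using spec[OF forced[unfolded f3_prop_def], of \<chi>] by blast
  have "n \<le> 2 * k + 1"
  proof (rule ccontr)
    assume "\<not> ?thesis"
    then have "2 * k + 1 \<le> card A" using A by (auto simp: nsets_def)
    then obtain A' where A': "A' \<subseteq> A" "card A' = 2 * k + 1"
      by (metis obtain_subset_with_card_n)
    then have "A' \<subseteq> {1..N}" using A by (auto simp: nsets_def)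
    with S A' obtain e where e: "e \<in> [A']\<^bsup>3\<^esup>" "e \<in> cyclic_triangles ?R" by blast
    then have "e \<in> [A]\<^bsup>3\<^esup>" using A' nsets_mono by blast
    then have "\<chi> e = Red" using A by blast
    then show False using e by (simp add: \<chi>_def)
  qed
  then show "enat n \<le> enat (2 * k + 1)" by simp
qed

lemma f3_upper_polylog:
  "\<forall>\<^sub>F N in sequentially. ereal_of_enat (f3 N (3 ^ j) (Suc (tri j))) < ereal (ln (real N) powr 2)"
proof -
  have "\<forall>\<^sub>F N in sequentially. 2 * (log 2 (real N) + 1) + 1 < ln (real N) powr 2"
    by real_asymp
  moreover have "\<forall>\<^sub>F N in sequentially. (1 :: nat) \<le> N" by (rule eventually_ge_at_top)
  ultimately show ?thesis
  proof eventually_elim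
    case (elim N)
    \<comment> \<open>The least exponent with \<open>N < 2 ^ k\<close>. The resulting bound is
      linear in log N, so the square of the logarithm eventually exceeds it.\<close>
    define k where "k = nat \<lfloor>log 2 (real N)\<rfloor> + 1"
    have "0 \<le> log 2 (real N)" using elim by simp
    then have k: "log 2 (real N) < real k" "real k \<le> log 2 (real N) + 1"
      unfolding k_def by linarith+
    have "real N < 2 powr real k" using k(1) elim by (simp add: log_less_iff)
    then have "real N < real (2 ^ k)" by (simp add: powr_realpow)
    then have "N < 2 ^ k" by (simp only: of_nat_less_iff)
    then have "ereal_of_enat (f3 N (3 ^ j) (Suc (tri j))) \<le> ereal_of_enat (enat (2 * k + 1))"
      by (simp only: ereal_of_enat_le_iff f3_upper)
    also have "\<dots> < ereal (ln (real N) powr 2)" using k elim by simp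
    finally show ?case .
  qed
qed

section \<open>Polynomial lower bound\<close>

lemma f3_lower_power:
  "\<exists>c>0. \<forall>\<^sub>F N in sequentially. ereal (real N powr c) < ereal_of_enat (f3 N (3 ^ j) (tri j))"
proof -
  obtain D where D: "\<forall>n\<ge>2. \<forall>(V :: nat set) B. finite V \<longrightarrow> n ^ D \<le> card V \<longrightarrow>
     (\<forall>A\<in>[V]\<^bsup>n\<^esup>. \<exists>e\<in>[A]\<^bsup>3\<^esup>. e \<in> B) \<longrightarrow>
     (\<exists>X\<subseteq>V. card X = 3 ^ j \<and> tri j \<le> card {e \<in> [X]\<^bsup>3\<^esup>. e \<in> B})"
    using tri_blue_in_large_set[of j, where 'a = nat] ..
  note D = D[rule_format]
  \<comment> \<open>The successor keeps the exponent positive even if \<open>D\<close> is 0.\<close>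
  define d where "d = real (Suc D)"
  have d: "0 < d" by (simp add: d_def)
  \<comment> \<open>Half of \<open>1 / d\<close>: the spare factor \<open>N powr c\<close> exceeds
    2, which pays for rounding \<open>N powr (1 / d)\<close> down to \<open>n\<close>.\<close>
  define c where "c = 1 / (2 * d)"
  have c: "0 < c" and dc: "1 / d = c + c" using d by (simp_all add: c_def)
  have "\<forall>\<^sub>F N in sequentially. 2 < real N powr c"
    using c by real_asymp
  moreover have "\<forall>\<^sub>F N in sequentially. (1 :: nat) \<le> N" by (rule eventually_ge_at_top)
  ultimately have "\<forall>\<^sub>F N in sequentially.
      ereal (real N powr c) < ereal_of_enat (f3 N (3 ^ j) (tri j))"
  proof eventually_elim
    case (elim N)
    have "2 * real N powr c < real N powr c * real N powr c"
      using elim by (intro mult_strict_right_mono) auto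
    also have "\<dots> = real N powr (1 / d)" by (simp only: dc powr_add)
    finally have large: "real N powr c + 2 < real N powr (1 / d)" using elim by linarith
    define n where "n = nat \<lfloor>real N powr (1 / d)\<rfloor>"
    have n: "real n \<le> real N powr (1 / d)" "real N powr (1 / d) < real n + 1"
      unfolding n_def by (simp_all add: of_nat_nat)
    have "0 < real N powr c" using elim by simp
    then have n2: "2 \<le> n" using n large by linarith
    have "real n ^ Suc D \<le> (real N powr (1 / d)) ^ Suc D" using n by (intro power_mono) auto
    also have "\<dots> = (real N powr (1 / d)) powr d"
      using elim by (simp add: d_def powr_realpow[symmetric] del: power_Suc)
    also have "\<dots> = real N" using d elim by (simp add: powr_powr)
    finally have "n ^ Suc D \<le> N" by (simp only: of_nat_power[symmetric] of_nat_le_iff)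
    moreover have "n ^ D \<le> n ^ Suc D" using n2 by simp
    ultimately have nD: "n ^ D \<le> card {1..N}" by (metis card_atLeastAtMost diff_Suc_1 order_trans)
    have "f3_prop N (3 ^ j) (tri j) n"
      unfolding f3_prop_def
    proof (intro allI disjCI)
      fix \<chi> :: "nat set \<Rightarrow> rb"
      assume *: "\<not> (\<exists>X\<in>nsets {1..N} (3 ^ j). tri j \<le> card {e \<in> [X]\<^bsup>3\<^esup>. \<chi> e = Blue})"
      show "\<exists>A\<in>[{1..N}]\<^bsup>n\<^esup>. \<forall>e\<in>[A]\<^bsup>3\<^esup>. \<chi> e = Red"
      proof (rule ccontr)
        assume "\<not> ?thesis"
        \<comment> \<open>Without a red \<open>n\<close>-set, the blue class meets the triples of
          every \<open>n\<close>-set, as the embedding requires of \<open>B\<close>.\<close>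
        then have "\<exists>e\<in>[A]\<^bsup>3\<^esup>. e \<in> {e. \<chi> e = Blue}" if "A \<in> [{1..N}]\<^bsup>n\<^esup>" for A
          using that rb.exhaust by blast
        from D[OF n2 _ nD this] obtain X where "X \<subseteq> {1..N}" "card X = 3 ^ j"
          "tri j \<le> card {e \<in> [X]\<^bsup>3\<^esup>. \<chi> e = Blue}" by auto
        moreover from this have "finite X" using finite_subset by blast
        ultimately show False using * by (auto simp: nsets_def)
      qed
    qed
    then have "enat n \<le> f3 N (3 ^ j) (tri j)" unfolding f3_def by (intro Sup_upper) auto
    then have "ereal_of_enat (enat n) \<le> ereal_of_enat (f3 N (3 ^ j) (tri j))"
      by (simp only: ereal_of_enat_le_iff)
    moreover have "ereal (real N powr c) < ereal_of_enat (enat n)"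
      using n large by simp
    ultimately show ?case by (rule less_le_trans[rotated])
  qed
  then show ?thesis using c by blast
qed

section \<open>Existence and uniqueness of the threshold\<close>

lemma f3_transition_tri: "f3_transition (3 ^ j) (Suc (tri j))"
proof -
  obtain c where "0 < c" and
    c: "\<forall>\<^sub>F N in sequentially. ereal (real N powr c) < ereal_of_enat (f3 N (3 ^ j) (tri j))"
    using f3_lower_power by blast
  show ?thesis
    unfolding f3_transition_def
  proof (intro conjI exI)
    show "\<forall>\<^sub>F N in sequentially.
        ereal (real N powr c) < ereal_of_enat (f3 N (3 ^ j) (Suc (tri j) - 1)) \<and>
        ereal_of_enat (f3 N (3 ^ j) (Suc (tri j))) < ereal (ln (real N) powr 2)"
      using eventually_conj[OF c f3_upper_polylog] by simp
  qed (use \<open>0 < c\<close> in auto)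
qed

text \<open>For \<open>t < t'\<close>, antitonicity would squeeze a power of N below a power of log
  N. Applied in both directions, this makes the transition unique.\<close>

lemma f3_transition_le:
  assumes t: "f3_transition s t" and t': "f3_transition s t'"
  shows "t' \<le> t"
proof (rule ccontr)
  assume "\<not> t' \<le> t"
  then have le: "t \<le> t' - 1" by simp
  obtain c where c: "0 < c" and
    up: "\<forall>\<^sub>F N in sequentially. ereal_of_enat (f3 N s t) < ereal (ln (real N) powr c)"
    using t unfolding f3_transition_def by (auto simp: eventually_conj_iff)
  obtain c' where c': "0 < c'" and
    low: "\<forall>\<^sub>F N in sequentially. ereal (real N powr c') < ereal_of_enat (f3 N s (t' - 1))"
    using t' unfolding f3_transition_def by (auto simp: eventually_conj_iff)
  have "\<forall>\<^sub>F N in sequentially. ln (real N) powr c < real N powr c'"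
    using c c' by real_asymp
  with up low have "\<forall>\<^sub>F N :: nat in sequentially. False"
  proof eventually_elim
    case (elim N)
    have "ereal (real N powr c') < ereal_of_enat (f3 N s (t' - 1))" by (fact elim)
    also have "\<dots> \<le> ereal_of_enat (f3 N s t)"
      using f3_antimono[OF le] by (simp only: ereal_of_enat_le_iff)
    also have "\<dots> < ereal (ln (real N) powr c)" by (fact elim)
    finally show False using elim by simp
  qed
  then show False by simp
qed

lemma h1_3_power_three: "h1_3 (3 ^ j) = Suc (tri j)"
  unfolding h1_3_def
  using f3_transition_tri f3_transition_le[OF _ f3_transition_tri] by (rule Least_equality)

theorem proposition5p3:
  fixes s j :: nat
  assumes "s = 3 ^ j"
  shows "f3_transition s (h1_3 s) \<and>
    real (g1_3 s) = real (h1_3 s) - 1 \<and>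
    real (h1_3 s) - 1 = real (F1 s) \<and>
    real (F1 s) = real (T s) \<and>
    real (T s) = 1 / 4 * real ((s + 1) choose 3)"
proof -
  \<comment> \<open>The chain \<open>tri j \<le> F1 s \<le> T s \<le> tri j\<close> closes
    up.\<close>
  have "F1 s = tri j" "T s = tri j"
    using tri_le_F1[of j] F1_le_T[of s] T_le_tri[of j] assms by auto
  then show ?thesis
    using f3_transition_tri[of j] h1_3_power_three[of j] g1_3_power_three[of j] tri_eq_choose[of j]
    by (simp add: assms)
qed

end
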